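(* Let $\nu\subseteq\mu\subset\lambda$ be Young diagrams with $\mu\nearrow\lambda$, such that the skew diagram $\lambda/\nu$ has $n$ boxes and is a broken border strip. Let $d_1,\dots,d_m$ be the labels (in the standard labelling of $\lambda/\nu$) of the dull boxes of $\lambda/\nu$, with $d_i$ the label of the box $\lambda/\mu$, and let $s_1,\dots,s_l$ be the labels of the sharp corners of $\lambda/\nu$. Then, as rational functions in indeterminates $x_1,\dots,x_n$, $$X_{\lambda/\nu,\mu/\nu}(x_1,\dots,x_n)=\frac{\prod_{j=1}^l(x_{d_i}-x_{s_j})}{\prod_{j=1,\,j\ne i}^m(x_{d_i}-x_{d_j})}\cdot\frac{1}{\prod_{R_{\lambda/\nu}}(x_j-x_i)\prod_{C_{\lambda/\nu}}(x_j-x_i)},$$ where $R_{\lambda/\nu}$ (resp. $C_{\lambda/\nu}$) is the set of pairs of labels $i<j$ whose boxes are adjacent in some row (resp. column) of $\lambda/\nu$.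
   Context: Young diagrams are identified with partitions; $\mu\nearrow\lambda$ means $\lambda$ is obtained from $\mu$ by adding one box. The standard labelling of a skew diagram $\lambda/\nu$ with $n$ boxes labels its boxes $1,\dots,n$ from left to right in each row, starting with the top row and proceeding downward. A broken border strip is a skew diagram containing no $2\times 2$ block of boxes. A sharp corner is a box of $\lambda/\nu$ having a box of $\lambda/\nu$ directly below it and one directly to its right; a dull box is a box of $\lambda/\nu$ with no box of $\lambda/\nu$ directly to its right and none directly below. Let $\ell$ be the label of the box $\lambda/\mu$. A standard tableau of shape $\mu/\nu$ is a filling of $\mu/\nu$ with $1,\dots,n-1$ increasing along rows and down columns; $\mathrm{SYT}(\mu/\nu)$ is their set. Each $T\in\mathrm{SYT}(\mu/\nu)$ is regarded as the bijection $T:\{1,\dots,n\}\setminus\{\ell\}\to\{1,\dots,n-1\}$ sending a label to the entry of $T$ in the box with that label. Define $X_{\lambda/\nu,\mu/\nu}(x_1,\dots,x_n)=\sum_{T\in\mathrm{SYT}(\mu/\nu)}\frac{1}{[x_{T^{-1}(2)}-x_{T^{-1}(1)}]\cdots[x_{T^{-1}(n-1)}-x_{T^{-1}(n-2)}]\,[x_{\ell}-x_{T^{-1}(n-1)}]}$. *)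

theory Defs
  imports
    "HOL-Library.Poly_Mapping"
    "HOL-Library.FuncSet"
    "HOL-Computational_Algebra.Fraction_Field"
begin

text \<open>A box is a pair (row, column), both counted from 0, with rows numbered downward.\<close>

type_synonym box = "nat \<times> nat"

definition is_partition :: "nat list \<Rightarrow> bool" where
  "is_partition la \<longleftrightarrow> sorted_wrt (\<ge>) la \<and> (\<forall>p\<in>set la. 0 < p)"

definition diagram :: "nat list \<Rightarrow> box set" where
  "diagram la = {(r, c). r < length la \<and> c < la ! r}"

definition adds_one_box :: "nat list \<Rightarrow> nat list \<Rightarrow> bool" where
  "adds_one_box mu la \<longleftrightarrow> (\<exists>b. b \<notin> diagram mu \<and> diagram la = insert b (diagram mu))"

definition skew :: "nat list \<Rightarrow> nat list \<Rightarrow> box set" where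
  "skew la nu = diagram la - diagram nu"

text \<open>The standard labelling: the label of a box is its position, counted from 1, when the boxes
  are read row by row from the top, each row from left to right.\<close>

definition label :: "box set \<Rightarrow> box \<Rightarrow> nat" where
  "label D b = card {b' \<in> D. fst b' < fst b \<or> (fst b' = fst b \<and> snd b' \<le> snd b)}"

definition box_of :: "box set \<Rightarrow> nat \<Rightarrow> box" where
  "box_of D = inv_into D (label D)"

definition broken_border_strip :: "box set \<Rightarrow> bool" where
  "broken_border_strip D \<longleftrightarrow>
     \<not> (\<exists>r c. {(r, c), (r, c + 1), (r + 1, c), (r + 1, c + 1)} \<subseteq> D)"

definition sharp_corners :: "box set \<Rightarrow> box set" where
  "sharp_corners D = {(r, c). (r, c) \<in> D \<and> (r + 1, c) \<in> D \<and> (r, c + 1) \<in> D}"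

definition dull_boxes :: "box set \<Rightarrow> box set" where
  "dull_boxes D = {(r, c). (r, c) \<in> D \<and> (r, c + 1) \<notin> D \<and> (r + 1, c) \<notin> D}"

text \<open>Fillings are total functions on boxes; requiring them to be extensional makes each tableau
  correspond to exactly one function, so that sums over \<open>SYT E\<close> count each tableau once.\<close>

definition SYT :: "box set \<Rightarrow> (box \<Rightarrow> nat) set" where
  "SYT E = {T \<in> extensional E. bij_betw T E {1..card E} \<and>
     (\<forall>r c c'. (r, c) \<in> E \<and> (r, c') \<in> E \<and> c < c' \<longrightarrow> T (r, c) < T (r, c')) \<and>
     (\<forall>r r' c. (r, c) \<in> E \<and> (r', c) \<in> E \<and> r < r' \<longrightarrow> T (r, c) < T (r', c))}"

text \<open>For \<open>D = \<lambda>/\<nu>\<close> and \<open>E = \<mu>/\<nu>\<close>, the difference \<open>D - E\<close> is the single box \<open>\<lambda>/\<mu>\<close>.\<close>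

definition added_label :: "box set \<Rightarrow> box set \<Rightarrow> nat" where
  "added_label D E = label D (the_elem (D - E))"

text \<open>The inverse of a tableau of shape \<open>E\<close> regarded as a bijection from the labels of \<open>D\<close> other
  than that of the added box to the entries.\<close>

definition tableau_inv :: "box set \<Rightarrow> box set \<Rightarrow> (box \<Rightarrow> nat) \<Rightarrow> nat \<Rightarrow> nat" where
  "tableau_inv D E T = inv_into ({1..card D} - {added_label D E}) (\<lambda>k. T (box_of D k))"

text \<open>If \<open>D\<close> consists of the added box only, the denominator is the empty product.\<close>

definition X_fun :: "box set \<Rightarrow> box set \<Rightarrow> (nat \<Rightarrow> 'f) \<Rightarrow> 'f::field" where
  "X_fun D E x = (let n = card D; l = added_label D E in
     \<Sum>T\<in>SYT E. let t = tableau_inv D E T in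
       1 / ((\<Prod>k = 2..n - 1. x (t k) - x (t (k - 1))) *
            (if n = 1 then 1 else x l - x (t (n - 1)))))"

definition row_pairs :: "box set \<Rightarrow> (nat \<times> nat) set" where
  "row_pairs D = {(i, j). i < j \<and> (\<exists>b\<in>D. \<exists>b'\<in>D. label D b = i \<and> label D b' = j \<and>
     fst b = fst b' \<and> (snd b' = snd b + 1 \<or> snd b = snd b' + 1))}"

definition col_pairs :: "box set \<Rightarrow> (nat \<times> nat) set" where
  "col_pairs D = {(i, j). i < j \<and> (\<exists>b\<in>D. \<exists>b'\<in>D. label D b = i \<and> label D b' = j \<and>
     snd b = snd b' \<and> (fst b' = fst b + 1 \<or> fst b = fst b' + 1))}"

text \<open>Polynomials over \<open>'k\<close> in indeterminates indexed by the natural numbers (monomials are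
  finitely supported exponent vectors), and their field of fractions.\<close>

type_synonym 'k multipoly = "(nat \<Rightarrow>\<^sub>0 nat) \<Rightarrow>\<^sub>0 'k"

type_synonym 'k ratfun = "'k multipoly fract"

definition indet :: "nat \<Rightarrow> 'k::field ratfun" where
  "indet i = Fract (Poly_Mapping.single (Poly_Mapping.single i 1) 1) 1"

end

theory Submission
  imports Defs "HOL-Computational_Algebra.Polynomial"
begin

text \<open>
  Group the tableaux of shape \<open>E\<close> by the box \<open>d\<close> holding the largest entry. That box is dull, and
  removing it gives the recursion \<open>G(E, b) = (\<Sum>d. G(E - {d}, d) / (x b - x d))\<close> for the sum \<open>G\<close>
  over the tableaux of shape \<open>E\<close>, followed by the box \<open>b\<close>. The claimed value of \<open>G(E, b)\<close> is a
  product over the boxes of \<open>E\<close> of factors \<open>h\<^sub>v(x b)\<close>, and when \<open>d\<close> is removed the factors of the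
  other boxes do not change at the point \<open>x d\<close>. The recursion thus reduces to Lagrange interpolation
  of \<open>\<Prod>s. (z - x s)\<close>, with \<open>s\<close> over the sharp corners, at the points \<open>x d\<close>, with \<open>d\<close> over the dull
  boxes. The interpolation is exact since a broken border strip has more dull boxes than
  sharp corners.
\<close>

section \<open>Lagrange interpolation\<close>

text \<open>The difference \<open>q\<close> of \<open>p\<close> and its Lagrange interpolant has
  degree below \<open>card A\<close> and vanishes at the \<open>card A\<close> distinct nodes, so it
  is zero. Evaluating at \<open>z\<close> and dividing by the nodal product, which is
  \<open>z - y a\<close> times the value of \<open>L a\<close>, gives this partial fraction
  form.\<close>

lemma lagrange_interpolation:
  fixes y :: "'a \<Rightarrow> 'f::field" and p :: "'f poly"
  assumes "finite A" "inj_on y A" "degree p < card A" "z \<notin> y ` A"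
  shows "(\<Sum>a\<in>A. poly p (y a) / ((\<Prod>a'\<in>A - {a}. y a - y a') * (z - y a)))
    = poly p z / (\<Prod>a\<in>A. z - y a)"
proof -
  define L where "L a = (\<Prod>a'\<in>A - {a}. [:- y a', 1:])" for a
  define w where "w a = poly p (y a) / (\<Prod>a'\<in>A - {a}. y a - y a')" for a
  define q where "q = p - (\<Sum>a\<in>A. smult (w a) (L a))"
  have poly_L: "poly (L a) u = (\<Prod>a'\<in>A - {a}. u - y a')" for a u
    by (simp add: L_def poly_prod)
  have ne: "(\<Prod>a'\<in>A - {a}. y a - y a') \<noteq> 0" if "a \<in> A" for a
    using that assms(1,2) by (auto simp: inj_on_def)
  have deg_L: "degree (L a) < card A" if "a \<in> A" for a
  proof -
    have "degree (L a) = (\<Sum>a'\<in>A - {a}. degree [:- y a', 1:])"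
      unfolding L_def by (intro degree_prod_eq_sum_degree) auto
    also have "\<dots> = card A - 1" using that assms(1) by simp
    finally show ?thesis using assms(3) by simp
  qed
  have "degree (\<Sum>a\<in>A. smult (w a) (L a)) < card A"
    using assms(3) deg_L by (intro degree_sum_less) (auto intro: le_less_trans[OF degree_smult_le])
  then have deg_q: "degree q < card A"
    unfolding q_def using assms(3) by (intro degree_diff_less)
  have root: "poly q (y a) = 0" if "a \<in> A" for a
  proof -
    \<comment> \<open>For \<open>a' \<noteq> a\<close> the product for \<open>L a'\<close> contains
      the factor \<open>y a - y a\<close>.\<close>
    have "w a' * poly (L a') (y a) = (if a' = a then poly p (y a) else 0)" if "a' \<in> A" for a'
      using that \<open>a \<in> A\<close> ne[of a] assms(1) by (auto simp: w_def poly_L)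
    then have "(\<Sum>a'\<in>A. w a' * poly (L a') (y a)) = poly p (y a)"
      using that assms(1) by simp
    then show ?thesis by (simp add: q_def poly_sum)
  qed
  have "q = 0"
  proof (rule ccontr)
    assume "q \<noteq> 0"
    then have "card (y ` A) \<le> degree q"
      using root by (intro order_trans[OF card_mono card_poly_roots_bound])
        (auto simp: poly_roots_finite)
    then show False using deg_q assms(2) by (simp add: card_image)
  qed
  then have "poly p z = (\<Sum>a\<in>A. w a * poly (L a) z)"
    by (simp add: q_def poly_sum)
  also have "\<dots> / (\<Prod>a\<in>A. z - y a)
      = (\<Sum>a\<in>A. poly p (y a) / ((\<Prod>a'\<in>A - {a}. y a - y a') * (z - y a)))"
  proof -
    have "w a * poly (L a) z / (\<Prod>a\<in>A. z - y a)
        = poly p (y a) / ((\<Prod>a'\<in>A - {a}. y a - y a') * (z - y a))" if "a \<in> A" for a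
    proof -
      have "(\<Prod>a\<in>A. z - y a) = (z - y a) * poly (L a) z"
        using that assms(1) by (simp add: poly_L prod.remove)
      moreover have "poly (L a) z \<noteq> 0"
        using assms(1,4) by (auto simp: poly_L)
      ultimately show ?thesis by (simp add: w_def)
    qed
    then show ?thesis by (simp add: sum_divide_distrib)
  qed
  finally show ?thesis by simp
qed

section \<open>Shapes closed under removal of dull boxes\<close>

text \<open>What the induction keeps of being a skew diagram, so that shapes can be plain sets of
  boxes instead of pairs of partitions.\<close>

definition rowcol_convex :: "box set \<Rightarrow> bool" where
  "rowcol_convex E \<longleftrightarrow>
     (\<forall>r c c' c''. (r, c) \<in> E \<and> (r, c'') \<in> E \<and> c \<le> c' \<and> c' \<le> c'' \<longrightarrow> (r, c') \<in> E) \<and>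
     (\<forall>c r r' r''. (r, c) \<in> E \<and> (r'', c) \<in> E \<and> r \<le> r' \<and> r' \<le> r'' \<longrightarrow> (r', c) \<in> E)"

text \<open>For skew diagrams this is equivalent to being a broken border strip, but unlike the latter it
  also forbids cycles in shapes with missing boxes and is inherited by all subsets.\<close>

definition no_hook :: "box set \<Rightarrow> bool" where
  "no_hook E \<longleftrightarrow> \<not> (\<exists>r c. {(r, c), (r + 1, c), (r + 1, c + 1)} \<subseteq> E)"

lemma no_hook_subset: "no_hook E \<Longrightarrow> F \<subseteq> E \<Longrightarrow> no_hook F"
  unfolding no_hook_def by blast

lemma dull_last_in_row:
  assumes "rowcol_convex E" "(r, c) \<in> dull_boxes E" "(r, c') \<in> E"
  shows "c' \<le> c"
proof (rule ccontr)
  assume "\<not> c' \<le> c"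
  then have "c \<le> c + 1" "c + 1 \<le> c'" by auto
  then have "(r, c + 1) \<in> E"
    using assms unfolding rowcol_convex_def dull_boxes_def by blast
  then show False using assms(2) by (simp add: dull_boxes_def)
qed

lemma dull_last_in_col:
  assumes "rowcol_convex E" "(r, c) \<in> dull_boxes E" "(r', c) \<in> E"
  shows "r' \<le> r"
proof (rule ccontr)
  assume "\<not> r' \<le> r"
  then have "r \<le> r + 1" "r + 1 \<le> r'" by auto
  then have "(r + 1, c) \<in> E"
    using assms unfolding rowcol_convex_def dull_boxes_def by blast
  then show False using assms(2) by (simp add: dull_boxes_def)
qed

text \<open>A dull box is the last of its row and of its column, so it never lies between two other
  boxes of \<open>E\<close>.\<close>

lemma rowcol_convex_remove_dull:
  assumes "rowcol_convex E" "d \<in> dull_boxes E"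
  shows "rowcol_convex (E - {d})"
proof -
  obtain r0 c0 where d: "d = (r0, c0)" by force
  have row: "(r, c') \<in> E - {d}"
    if "(r, c) \<in> E - {d}" "(r, c'') \<in> E - {d}" "c \<le> c'" "c' \<le> c''" for r c c' c''
  proof -
    have "(r, c') \<in> E" using that assms(1) unfolding rowcol_convex_def by blast
    moreover have "(r, c') \<noteq> d"
      using that assms dull_last_in_row[of E r0 c0 c''] by (auto simp: d)
    ultimately show ?thesis by simp
  qed
  have col: "(r', c) \<in> E - {d}"
    if "(r, c) \<in> E - {d}" "(r'', c) \<in> E - {d}" "r \<le> r'" "r' \<le> r''" for c r r' r''
  proof -
    have "(r', c) \<in> E" using that assms(1) unfolding rowcol_convex_def by blast
    moreover have "(r', c) \<noteq> d"
      using that assms dull_last_in_col[of E r0 c0 r''] by (auto simp: d)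
    ultimately show ?thesis by simp
  qed
  show ?thesis unfolding rowcol_convex_def using row col by blast
qed

text \<open>Count adjacencies, charging a horizontal one to its left box and a vertical one to its
  lower box. Without a hook no box is charged twice, and the last box of the top row is not charged
  at all, so \<open>card R + card B < card E\<close>. Inclusion-exclusion then gives the claim, the
  sharp corners being \<open>R \<inter> B\<close> and the dull boxes the complement of
  \<open>R \<union> B\<close>.\<close>

lemma card_sharp_less_card_dull:
  assumes "finite E" "E \<noteq> {}" "no_hook E"
  shows "card (sharp_corners E) < card (dull_boxes E)"
proof -
  define R where "R = {(r, c). (r, c) \<in> E \<and> (r, c + 1) \<in> E}"
  define B where "B = {(r, c). (r, c) \<in> E \<and> (r + 1, c) \<in> E}"
  define below :: "box \<Rightarrow> box" where "below = (\<lambda>(r, c). (r + 1, c))"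
  have sub: "R \<subseteq> E" "B \<subseteq> E" "below ` B \<subseteq> E" by (auto simp: R_def B_def below_def)
  have fin: "finite R" "finite B" using sub assms(1) finite_subset by auto
  have sharp: "sharp_corners E = R \<inter> B" by (auto simp: sharp_corners_def R_def B_def)
  have dull: "dull_boxes E = E - (R \<union> B)" by (auto simp: dull_boxes_def R_def B_def)
  define r0 where "r0 = Min (fst ` E)"
  define c0 where "c0 = Max {c. (r0, c) \<in> E}"
  have "r0 \<in> fst ` E" unfolding r0_def using assms by (intro Min_in) auto
  then have ne: "{c. (r0, c) \<in> E} \<noteq> {}" by force
  have finr: "finite {c. (r0, c) \<in> E}"
    by (rule finite_subset[of _ "snd ` E"]) (use assms in force)+
  have mem: "(r0, c0) \<in> E" using Max_in[OF finr ne] by (simp add: c0_def)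
  have "(r0, c0 + 1) \<notin> E"
    using Max_ge[OF finr, of "c0 + 1"] by (auto simp: c0_def[symmetric])
  then have notR: "(r0, c0) \<notin> R" by (simp add: R_def)
  have minr: "r0 \<le> r" if "(r, c) \<in> E" for r c
    unfolding r0_def using that assms by (intro Min_le) force+
  have notB: "(r0, c0) \<notin> below ` B"
    using minr by (force simp: below_def B_def)
  have "R \<inter> below ` B = {}"
    using assms(3) by (auto simp: R_def B_def below_def no_hook_def)
  moreover have "card (below ` B) = card B"
    by (intro card_image) (auto simp: inj_on_def below_def)
  ultimately have "card R + card B = card (R \<union> below ` B)"
    using fin by (simp add: card_Un_disjoint)
  also have "\<dots> < card E"
    using assms(1) sub mem notR notB by (intro psubset_card_mono) auto
  finally have "card R + card B < card E" .
  moreover have "card R + card B = card (R \<union> B) + card (R \<inter> B)"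
    using fin by (rule card_Un_Int)
  moreover have "card (E - (R \<union> B)) = card E - card (R \<union> B)"
    using fin sub by (intro card_Diff_subset) auto
  ultimately show ?thesis unfolding sharp dull by linarith
qed

section \<open>The sum over tableaux\<close>

text \<open>The denominator of a summand of \<open>X_fun\<close>, with boxes in place of labels. The
  closing box \<open>b\<close> is a separate parameter because the recursion replaces it by the
  removed box.\<close>

definition tableau_chain :: "(box \<Rightarrow> 'f::field) \<Rightarrow> box set \<Rightarrow> box \<Rightarrow> (box \<Rightarrow> nat) \<Rightarrow> 'f" where
  "tableau_chain y E b T =
     (\<Prod>k = 2..card E. y (inv_into E T k) - y (inv_into E T (k - 1))) *
     (if E = {} then 1 else y b - y (inv_into E T (card E)))"

lemma bij_betw_remove:
  assumes "bij_betw f A B" "a \<in> A"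
  shows "bij_betw f (A - {a}) (B - {f a})"
  using assms by (auto simp: bij_betw_def inj_on_def)

lemma SYT_bij: "T \<in> SYT E \<Longrightarrow> bij_betw T E {1..card E}"
  by (simp add: SYT_def)

lemma finite_SYT:
  assumes "finite E"
  shows "finite (SYT E)"
proof (rule finite_subset)
  show "SYT E \<subseteq> (\<Pi>\<^sub>E _\<in>E. {1..card E})"
    by (auto simp: SYT_def PiE_def dest!: bij_betwE)
  show "finite (\<Pi>\<^sub>E _\<in>E. {1..card E})"
    using assms by (intro finite_PiE) auto
qed

lemma SYT_empty: "SYT {} = {\<lambda>_. undefined}"
  by (auto simp: SYT_def bij_betw_def)

lemma SYT_top_box:
  assumes "finite E" "E \<noteq> {}" "T \<in> SYT E"
  shows "inv_into E T (card E) \<in> dull_boxes E" and "T (inv_into E T (card E)) = card E"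
proof -
  let ?d = "inv_into E T (card E)"
  have img: "T ` E = {1..card E}" using SYT_bij[OF assms(3)] by (simp add: bij_betw_def)
  moreover have "card E \<in> {1..card E}" using assms by (simp add: Suc_le_eq card_gt_0_iff)
  ultimately have in_img: "card E \<in> T ` E" by simp
  then have dE: "?d \<in> E" by (rule inv_into_into)
  show Td: "T ?d = card E" using in_img by (rule f_inv_into_f)
  obtain r c where d: "?d = (r, c)" by force
  have le: "T v \<le> card E" if "v \<in> E" for v using img that by auto
  have "(r, c + 1) \<notin> E"
  proof
    assume "(r, c + 1) \<in> E"
    moreover from this have "T (r, c) < T (r, c + 1)"
      using dE assms(3) by (auto simp: SYT_def d)
    ultimately show False using le[of "(r, c + 1)"] Td by (simp add: d)
  qed
  moreover have "(r + 1, c) \<notin> E"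
  proof
    assume "(r + 1, c) \<in> E"
    moreover from this have "T (r, c) < T (r + 1, c)"
      using dE assms(3) by (auto simp: SYT_def d)
    ultimately show False using le[of "(r + 1, c)"] Td by (simp add: d)
  qed
  ultimately show "?d \<in> dull_boxes E" using dE by (simp add: dull_boxes_def d)
qed

lemma SYT_remove_top:
  assumes "finite E" "d \<in> E" "T \<in> SYT E" "T d = card E"
  shows "restrict T (E - {d}) \<in> SYT (E - {d})"
proof -
  have "card E > 0" using assms by (auto simp: card_gt_0_iff)
  then have "{1..card E} - {card E} = {1..card (E - {d})}"
    using assms by auto
  moreover have "bij_betw T (E - {d}) ({1..card E} - {card E})"
    using bij_betw_remove[OF SYT_bij[OF assms(3)] assms(2)] assms(4) by simp
  ultimately have "bij_betw (restrict T (E - {d})) (E - {d}) {1..card (E - {d})}"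
    by (subst bij_betw_cong[of _ _ T]) auto
  then show ?thesis using assms(3) by (auto simp: SYT_def)
qed

text \<open>\<open>card E\<close> exceeds all entries of \<open>T\<close>, so only a comparison with
  \<open>d\<close> as the left or upper box could fail, and there is none because \<open>d\<close>
  ends its row and its column.\<close>

lemma SYT_add_top:
  assumes "finite E" "rowcol_convex E" "d \<in> dull_boxes E" "T \<in> SYT (E - {d})"
  shows "T(d := card E) \<in> SYT E"
proof -
  obtain r0 c0 where d: "d = (r0, c0)" by force
  have dE: "d \<in> E" using assms(3) by (auto simp: dull_boxes_def d)
  have pos: "card E > 0" using assms(1) dE by (auto simp: card_gt_0_iff)
  have bij: "bij_betw T (E - {d}) {1..card E - 1}"
    using SYT_bij[OF assms(4)] assms(1) dE by simp
  have lt: "T v < card E" if "v \<in> E" "v \<noteq> d" for v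
  proof -
    have "T v \<in> {1..card E - 1}" using bij_betwE[OF bij] that by blast
    then show ?thesis using pos by auto
  qed
  have "bij_betw (T(d := card E)) (E - {d}) {1..card E - 1}"
    using bij by (subst bij_betw_cong[of _ _ T]) auto
  then have "bij_betw (T(d := card E)) (insert d (E - {d})) (insert (card E) {1..card E - 1})"
    using notIn_Un_bij_betw[of d "E - {d}" "T(d := card E)" "{1..card E - 1}"] pos by simp
  moreover have "insert (card E) {1..card E - 1} = {1..card E}" using pos by auto
  ultimately have "bij_betw (T(d := card E)) E {1..card E}"
    using dE by (simp add: insert_absorb)
  moreover have "T(d := card E) \<in> extensional E"
    using assms(4) dE by (auto simp: SYT_def extensional_def)
  moreover have "(T(d := card E)) (r, c) < (T(d := card E)) (r, c')"
    if "(r, c) \<in> E" "(r, c') \<in> E" "c < c'" for r c c'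
  proof -
    have "(r, c) \<noteq> d" using that dull_last_in_row[of E r c c'] assms by auto
    then show ?thesis using that lt[of "(r, c)"] assms(4) by (auto simp: SYT_def)
  qed
  moreover have "(T(d := card E)) (r, c) < (T(d := card E)) (r', c)"
    if "(r, c) \<in> E" "(r', c) \<in> E" "r < r'" for r r' c
  proof -
    have "(r, c) \<noteq> d" using that dull_last_in_col[of E r c r'] assms by auto
    then show ?thesis using that lt[of "(r, c)"] assms(4) by (auto simp: SYT_def)
  qed
  ultimately show ?thesis unfolding SYT_def by blast
qed

text \<open>Restricting \<open>T\<close> does not move the entries below \<open>card E\<close>. The
  last difference in the product for \<open>E\<close> becomes the closing factor of the smaller
  chain, and \<open>y b - y d\<close> remains.\<close>

lemma tableau_chain_remove_top:
  assumes "finite E" "d \<in> E" "T \<in> SYT E" "T d = card E"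
  shows "tableau_chain y E b T
    = tableau_chain y (E - {d}) d (restrict T (E - {d})) * (y b - y d)"
proof -
  let ?T = "restrict T (E - {d})"
  have inj: "inj_on T E" using SYT_bij[OF assms(3)] by (simp add: bij_betw_def)
  have top: "inv_into E T (card E) = d"
    using inj assms(2,4) by (metis inv_into_f_f)
  have inv_eq: "inv_into (E - {d}) ?T k = inv_into E T k" if k: "k \<in> {1..card (E - {d})}" for k
  proof -
    have bij: "bij_betw ?T (E - {d}) {1..card (E - {d})}"
      by (rule SYT_bij[OF SYT_remove_top[OF assms]])
    then obtain v where v: "v \<in> E - {d}" "?T v = k"
      using k by (metis bij_betw_imp_surj_on imageE)
    have "inv_into (E - {d}) ?T k = v"
      using bij v by (intro inv_into_f_eq) (auto simp: bij_betw_def)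
    moreover have "inv_into E T k = v"
      using inj v by (intro inv_into_f_eq) auto
    ultimately show ?thesis by simp
  qed
  show ?thesis
  \<comment> \<open>A single box leaves the empty shape, where the closing factor is 1 by
    convention.\<close>
  proof (cases "E = {d}")
    case True
    then show ?thesis using top by (simp add: tableau_chain_def)
  next
    case False
    let ?N = "card (E - {d})"
    have cE: "card E = Suc ?N" using card_Suc_Diff1[OF assms(1,2)] by simp
    have ne: "E - {d} \<noteq> {}" "E \<noteq> {}" using assms(2) False by auto
    then have N: "?N \<ge> 1" using assms(1) by (simp add: Suc_le_eq card_gt_0_iff)
    have top_factor: "(\<Prod>k = 2..card E. y (inv_into E T k) - y (inv_into E T (k - 1)))
      = (\<Prod>k = 2..?N. y (inv_into E T k) - y (inv_into E T (k - 1)))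
        * (y d - y (inv_into E T ?N))"
      using N top by (simp add: cE)
    have rest: "(\<Prod>k = 2..?N. y (inv_into E T k) - y (inv_into E T (k - 1)))
      = (\<Prod>k = 2..?N. y (inv_into (E - {d}) ?T k) - y (inv_into (E - {d}) ?T (k - 1)))"
    proof (intro prod.cong refl)
      fix k assume "k \<in> {2..?N}"
      then have "k \<in> {1..?N}" "k - 1 \<in> {1..?N}" by auto
      then show "y (inv_into E T k) - y (inv_into E T (k - 1))
        = y (inv_into (E - {d}) ?T k) - y (inv_into (E - {d}) ?T (k - 1))"
        by (simp only: inv_eq)
    qed
    have "inv_into E T ?N = inv_into (E - {d}) ?T ?N" using N inv_eq[of ?N] by simp
    then show ?thesis
      by (simp only: tableau_chain_def top_factor rest top ne if_False)
  qed
qed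

text \<open>A tableau corresponds to the pair of the box \<open>d\<close> holding its largest entry
  and the tableau left after removing \<open>d\<close>; its chain then loses the factor
  \<open>y b - y d\<close>.\<close>

lemma sum_tableaux_rec:
  fixes y :: "box \<Rightarrow> 'f::field"
  assumes "finite E" "E \<noteq> {}" "rowcol_convex E"
  shows "(\<Sum>T\<in>SYT E. 1 / tableau_chain y E b T)
    = (\<Sum>d\<in>dull_boxes E. (\<Sum>T\<in>SYT (E - {d}). 1 / tableau_chain y (E - {d}) d T) / (y b - y d))"
proof -
  let ?top = "\<lambda>T. inv_into E T (card E)"
  have dull_sub: "dull_boxes E \<subseteq> E" by (auto simp: dull_boxes_def)
  have fin: "finite (dull_boxes E)" using assms(1) dull_sub by (rule finite_subset[rotated])
  have "(\<Sum>d\<in>dull_boxes E. (\<Sum>T\<in>SYT (E - {d}). 1 / tableau_chain y (E - {d}) d T) / (y b - y d))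
    = (\<Sum>(d, T)\<in>Sigma (dull_boxes E) (\<lambda>d. SYT (E - {d})).
        1 / tableau_chain y (E - {d}) d T / (y b - y d))"
    using fin finite_SYT assms(1) by (simp add: sum_divide_distrib sum.Sigma)
  also have "\<dots> = (\<Sum>T\<in>SYT E. 1 / tableau_chain y E b T)"
  proof (rule sum.reindex_bij_witness[where j = "\<lambda>(d, T). T(d := card E)"
        and i = "\<lambda>T. (?top T, restrict T (E - {?top T}))"])
    fix T assume T: "T \<in> SYT E"
    note top = SYT_top_box[OF assms(1,2) T]
    have dE: "?top T \<in> E" using top dull_sub by blast
    show "(?top T, restrict T (E - {?top T})) \<in> Sigma (dull_boxes E) (\<lambda>d. SYT (E - {d}))"
      using top SYT_remove_top[OF assms(1) dE T] by simp
    have "T \<in> extensional E" using T by (simp add: SYT_def)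
    then show "(case (?top T, restrict T (E - {?top T})) of (d, T) \<Rightarrow> T(d := card E)) = T"
      using top dE by (auto simp: fun_eq_iff restrict_def extensional_def)
  next
    fix p assume p: "p \<in> Sigma (dull_boxes E) (\<lambda>d. SYT (E - {d}))"
    obtain d T where dT: "p = (d, T)" by (cases p)
    have d: "d \<in> dull_boxes E" and T: "T \<in> SYT (E - {d})" using p dT by auto
    have dE: "d \<in> E" using d dull_sub by blast
    let ?T = "T(d := card E)"
    have ST: "?T \<in> SYT E" by (rule SYT_add_top[OF assms(1,3) d T])
    then show "(case p of (d, T) \<Rightarrow> T(d := card E)) \<in> SYT E" by (simp add: dT)
    have top: "?top ?T = d"
      using SYT_bij[OF ST] dE by (intro inv_into_f_eq) (auto simp: bij_betw_def)
    have "T \<in> extensional (E - {d})" using T by (simp add: SYT_def)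
    then have restr: "restrict ?T (E - {d}) = T"
      by (auto simp: fun_eq_iff restrict_def extensional_def)
    show "(?top (case p of (d, T) \<Rightarrow> T(d := card E)),
        restrict (case p of (d, T) \<Rightarrow> T(d := card E))
          (E - {?top (case p of (d, T) \<Rightarrow> T(d := card E))})) = p"
      using top restr by (simp add: dT)
    show "1 / tableau_chain y E b (case p of (d, T) \<Rightarrow> T(d := card E))
      = (case p of (d, T) \<Rightarrow> 1 / tableau_chain y (E - {d}) d T / (y b - y d))"
      using tableau_chain_remove_top[OF assms(1) dE ST, of y b] restr by (simp add: dT)
  qed
  finally show ?thesis by simp
qed

section \<open>The product formula\<close>

text \<open>Each adjacency is assigned to its left or upper box, so the product over
  \<open>E\<close> meets every adjacent pair once. Dull boxes have weight 1.\<close>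

definition edge_weight :: "(box \<Rightarrow> 'f::field) \<Rightarrow> box set \<Rightarrow> box \<Rightarrow> 'f" where
  "edge_weight y E = (\<lambda>(r, c).
     (if (r, c + 1) \<in> E then y (r, c + 1) - y (r, c) else 1) *
     (if (r + 1, c) \<in> E then y (r + 1, c) - y (r, c) else 1))"

text \<open>The share of \<open>v\<close> in the claimed product, as a function of the point
  \<open>z\<close> that stands for the value at the closing box.\<close>

definition box_factor :: "(box \<Rightarrow> 'f::field) \<Rightarrow> box set \<Rightarrow> 'f \<Rightarrow> box \<Rightarrow> 'f" where
  "box_factor y E z v =
     (if v \<in> sharp_corners E then z - y v else 1) /
     ((if v \<in> dull_boxes E then z - y v else 1) * edge_weight y E v)"

text \<open>The index set \<open>A\<close> is kept apart from \<open>E\<close> because a removed box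
  may be left out of the product while corners and edges still refer to the full shape.\<close>

lemma prod_box_factor:
  assumes "finite A"
  shows "(\<Prod>v\<in>A. box_factor y E z v) =
    (\<Prod>s\<in>A \<inter> sharp_corners E. z - y s) /
    ((\<Prod>d\<in>A \<inter> dull_boxes E. z - y d) * (\<Prod>v\<in>A. edge_weight y E v))"
  using assms by (simp add: box_factor_def prod_dividef prod.distrib prod.inter_restrict)

text \<open>If \<open>d\<close> is a neighbour of \<open>v\<close>, its removal makes \<open>v\<close> either lose its sharpness or become dull;
  either way the lost edge factor \<open>y d - y v\<close> is compensated exactly at \<open>z = y d\<close>.\<close>

lemma box_factor_remove:
  assumes "v \<in> E" "v \<noteq> d" "y v \<noteq> y d"
  shows "box_factor y (E - {d}) (y d) v = box_factor y E (y d) v"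
proof -
  obtain r c where v: "v = (r, c)" by force
  \<comment> \<open>The factor depends on \<open>F\<close> only through the right and the lower
    neighbour of \<open>v\<close>, so only their removal matters.\<close>
  have factor: "box_factor y F z v =
      (if (r, c + 1) \<in> F \<and> (r + 1, c) \<in> F then z - y v else 1) /
      ((if (r, c + 1) \<notin> F \<and> (r + 1, c) \<notin> F then z - y v else 1) *
       ((if (r, c + 1) \<in> F then y (r, c + 1) - y v else 1) *
        (if (r + 1, c) \<in> F then y (r + 1, c) - y v else 1)))" if "v \<in> F" for F z
    using that by (simp add: v box_factor_def edge_weight_def sharp_corners_def dull_boxes_def)
  have nz: "y d - y v \<noteq> 0" using assms(3) by simp
  have vF: "v \<in> E - {d}" using assms by simp
  consider "d = (r, c + 1)" | "d = (r + 1, c)" | "d \<noteq> (r, c + 1)" "d \<noteq> (r + 1, c)" by blast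
  then show ?thesis
  proof cases
    case 1
    then have "(r + 1, c) \<noteq> d" by simp
    then show ?thesis unfolding factor[OF vF] factor[OF assms(1)] 1[symmetric] using nz by simp
  next
    case 2
    then have "(r, c + 1) \<noteq> d" by simp
    then show ?thesis unfolding factor[OF vF] factor[OF assms(1)] 2[symmetric] using nz by simp
  next
    case 3
    then have "(r, c + 1) \<in> E - {d} \<longleftrightarrow> (r, c + 1) \<in> E"
      "(r + 1, c) \<in> E - {d} \<longleftrightarrow> (r + 1, c) \<in> E" by auto
    then show ?thesis unfolding factor[OF vF] factor[OF assms(1)] by (simp only:)
  qed
qed

text \<open>Induction on the size, for all closing boxes at once since the recursion closes the
  smaller tableaux with \<open>d\<close>. The summands become Lagrange terms for \<open>p\<close> at
  the dull boxes over the common denominator \<open>W\<close>, and interpolation evaluates their sum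
  at \<open>y b\<close>.\<close>

lemma sum_tableaux_eq_prod:
  fixes y :: "box \<Rightarrow> 'f::field"
  assumes "finite E" "rowcol_convex E" "no_hook E" "inj_on y E" "y b \<notin> y ` E"
  shows "(\<Sum>T\<in>SYT E. 1 / tableau_chain y E b T) = (\<Prod>v\<in>E. box_factor y E (y b) v)"
  using assms
proof (induction "card E" arbitrary: E b rule: less_induct)
  case less
  show ?case
  proof (cases "E = {}")
    case True
    then show ?thesis by (simp add: SYT_empty tableau_chain_def)
  next
    case False
    let ?S = "sharp_corners E" and ?D = "dull_boxes E"
    have sub: "?S \<subseteq> E" "?D \<subseteq> E" "?S \<inter> ?D = {}"
      by (auto simp: sharp_corners_def dull_boxes_def)
    have finD: "finite ?D" and finS: "finite ?S"
      using sub less.prems(1) by (auto intro: finite_subset)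
    \<comment> \<open>The polynomial to interpolate: having fewer sharp corners than dull boxes
      keeps its degree below the number of nodes.\<close>
    define p where "p = (\<Prod>s\<in>?S. [:- y s, 1:])"
    have poly_p: "poly p z = (\<Prod>s\<in>?S. z - y s)" for z by (simp add: p_def poly_prod)
    define W where "W = (\<Prod>v\<in>E. edge_weight y E v)"
    have "degree p = (\<Sum>s\<in>?S. degree [:- y s, 1:])"
      unfolding p_def by (intro degree_prod_eq_sum_degree) auto
    then have deg: "degree p < card ?D"
      using card_sharp_less_card_dull[OF less.prems(1) False less.prems(3)] by simp
    have summand: "(\<Sum>T\<in>SYT (E - {d}). 1 / tableau_chain y (E - {d}) d T)
        = poly p (y d) / (\<Prod>d'\<in>?D - {d}. y d - y d') / W" if d: "d \<in> ?D" for d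
    proof -
      have dE: "d \<in> E" using d sub by blast
      have "(\<Sum>T\<in>SYT (E - {d}). 1 / tableau_chain y (E - {d}) d T)
          = (\<Prod>v\<in>E - {d}. box_factor y (E - {d}) (y d) v)"
      proof (rule less.hyps)
        show "card (E - {d}) < card E" using dE less.prems(1) by (rule card_Diff1_less[rotated])
        show "rowcol_convex (E - {d})" by (rule rowcol_convex_remove_dull[OF less.prems(2) d])
        show "y d \<notin> y ` (E - {d})" using less.prems(4) dE by (auto dest: inj_onD)
      qed (use less.prems in \<open>auto intro: no_hook_subset inj_on_subset\<close>)
      also have "\<dots> = (\<Prod>v\<in>E - {d}. box_factor y E (y d) v)"
        using less.prems(4) dE by (intro prod.cong box_factor_remove) (auto dest: inj_onD)
      also have "\<dots> = (\<Prod>s\<in>(E - {d}) \<inter> ?S. y d - y s) /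
          ((\<Prod>d'\<in>(E - {d}) \<inter> ?D. y d - y d') * (\<Prod>v\<in>E - {d}. edge_weight y E v))"
        using less.prems(1) by (intro prod_box_factor) auto
      also have "(E - {d}) \<inter> ?S = ?S" using sub d by auto
      also have "(E - {d}) \<inter> ?D = ?D - {d}" using sub by auto
      \<comment> \<open>The omitted box is dull and has edge weight 1, so the denominator is the
        same for every \<open>d\<close>.\<close>
      also have "(\<Prod>v\<in>E - {d}. edge_weight y E v) = W"
        using less.prems(1) dE d unfolding W_def
        by (cases d) (simp add: prod.remove[of E d] edge_weight_def dull_boxes_def)
      finally show ?thesis by (simp add: poly_p)
    qed
    have "(\<Sum>T\<in>SYT E. 1 / tableau_chain y E b T)
        = (\<Sum>d\<in>?D. poly p (y d) / (\<Prod>d'\<in>?D - {d}. y d - y d') / W / (y b - y d))"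
      unfolding sum_tableaux_rec[OF less.prems(1) False less.prems(2)]
      by (intro sum.cong) (auto simp: summand)
    also have "\<dots>
        = (\<Sum>d\<in>?D. poly p (y d) / ((\<Prod>d'\<in>?D - {d}. y d - y d') * (y b - y d))) / W"
      by (simp add: sum_divide_distrib mult_ac)
    also have "\<dots> = poly p (y b) / (\<Prod>d\<in>?D. y b - y d) / W"
      using finD deg less.prems(4,5) sub
      by (subst lagrange_interpolation) (auto intro: inj_on_subset)
    also have "\<dots> = (\<Prod>v\<in>E. box_factor y E (y b) v)"
      using less.prems(1) sub by (simp add: prod_box_factor poly_p W_def Int_absorb1)
    finally show ?thesis .
  qed
qed

section \<open>Skew diagrams and their labels\<close>

lemma finite_diagram: "finite (diagram la)"
proof (rule finite_subset)
  show "diagram la \<subseteq> Sigma {..<length la} (\<lambda>r. {..<la ! r})" by (auto simp: diagram_def)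
qed auto

lemma diagram_down_closed:
  assumes "is_partition la" "(r, c) \<in> diagram la" "r' \<le> r" "c' \<le> c"
  shows "(r', c') \<in> diagram la"
proof -
  have "la ! r \<le> la ! r'"
    using assms by (cases "r' = r") (auto simp: is_partition_def diagram_def sorted_wrt_iff_nth_less)
  then show ?thesis using assms by (auto simp: diagram_def)
qed

text \<open>Between two boxes of a row or column, membership in \<open>diagram la\<close> is
  inherited from the later one and absence from \<open>diagram nu\<close> from the earlier
  one.\<close>

lemma rowcol_convex_skew:
  assumes "is_partition la" "is_partition nu"
  shows "rowcol_convex (skew la nu)"
  unfolding rowcol_convex_def skew_def
  using diagram_down_closed[OF assms(1)] diagram_down_closed[OF assms(2)]
  by (meson DiffD1 DiffD2 DiffI order_refl)

text \<open>The missing fourth box \<open>(r, c + 1)\<close> of a hook lies in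
  \<open>diagram la\<close> because the box below it does, and outside \<open>diagram nu\<close>
  because its left neighbour does, so the hook would complete to a full block.\<close>

lemma no_hook_skew:
  assumes "is_partition la" "is_partition nu" "broken_border_strip (skew la nu)"
  shows "no_hook (skew la nu)"
  unfolding no_hook_def
proof clarify
  fix r c assume sub: "{(r, c), (r + 1, c), (r + 1, c + 1)} \<subseteq> skew la nu"
  have "(r, c + 1) \<in> diagram la"
    using sub diagram_down_closed[OF assms(1), of "r + 1" "c + 1" r "c + 1"] by (auto simp: skew_def)
  moreover have "(r, c + 1) \<notin> diagram nu"
    using sub diagram_down_closed[OF assms(2), of r "c + 1" r c] by (auto simp: skew_def)
  ultimately show False
    using sub assms(3) unfolding broken_border_strip_def by (auto simp: skew_def)
qed

section \<open>Labels as positions in reading order\<close>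

lemma label_less:
  assumes "finite D" "b' \<in> D" "fst b < fst b' \<or> fst b = fst b' \<and> snd b < snd b'"
  shows "label D b < label D b'"
  unfolding label_def using assms by (intro psubset_card_mono) auto

lemma label_less_iff:
  assumes "finite D" "b \<in> D" "b' \<in> D"
  shows "label D b < label D b' \<longleftrightarrow> fst b < fst b' \<or> fst b = fst b' \<and> snd b < snd b'"
  using label_less[OF assms(1,3), of b] label_less[OF assms(1,2), of b']
  by (metis less_irrefl less_trans linorder_neqE_nat prod_eqI)

text \<open>Labels strictly increase along the total reading order, hence are injective. Every box
  counts itself, so they lie between 1 and \<open>card D\<close>, and comparing cardinalities gives
  surjectivity.\<close>

lemma label_bij:
  assumes "finite D"
  shows "bij_betw (label D) D {1..card D}"
proof -
  have inj: "inj_on (label D) D"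
    using label_less_iff[OF assms] by (intro inj_onI) (metis less_irrefl linorder_neqE_nat prod_eqI)
  have "label D ` D \<subseteq> {1..card D}"
  proof clarify
    fix r c assume b: "(r, c) \<in> D"
    have "label D (r, c) \<le> card D"
      unfolding label_def using assms by (intro card_mono) auto
    moreover have "label D (r, c) > 0"
      unfolding label_def using assms b by (auto simp: card_gt_0_iff)
    ultimately show "label D (r, c) \<in> {1..card D}" by simp
  qed
  then have "label D ` D = {1..card D}"
    using assms inj by (intro card_subset_eq) (auto simp: card_image)
  then show ?thesis using inj by (simp add: bij_betw_def)
qed

lemma box_of_label:
  assumes "finite D" "v \<in> D"
  shows "box_of D (label D v) = v"
  using label_bij[OF assms(1)] assms(2) by (simp add: box_of_def bij_betw_def)

text \<open>Moves the inversion from labels to boxes: \<open>box_of\<close> undoes the labelling,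
  and injectivity of the composed map makes \<open>inv_into\<close> return the label of the box with
  entry \<open>k\<close>.\<close>

lemma tableau_inv_eq:
  assumes "finite D" "b \<in> D" "T \<in> SYT (D - {b})" "k \<in> {1..card (D - {b})}"
  shows "tableau_inv D (D - {b}) T k = label D (inv_into (D - {b}) T k)"
proof -
  have Tbij: "bij_betw T (D - {b}) {1..card (D - {b})}" by (rule SYT_bij[OF assms(3)])
  have "D - (D - {b}) = {b}" using assms(2) by blast
  then have added: "added_label D (D - {b}) = label D b" by (simp add: added_label_def)
  have lab: "bij_betw (label D) (D - {b}) ({1..card D} - {label D b})"
    by (rule bij_betw_remove[OF label_bij[OF assms(1)] assms(2)])
  have inj: "inj_on (\<lambda>k. T (box_of D k)) ({1..card D} - {label D b})"
  proof (rule inj_onI)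
    fix i j assume ij: "i \<in> {1..card D} - {label D b}" "j \<in> {1..card D} - {label D b}"
      "T (box_of D i) = T (box_of D j)"
    then obtain u v where uv: "u \<in> D - {b}" "v \<in> D - {b}" "i = label D u" "j = label D v"
      unfolding bij_betw_imp_surj_on[OF lab, symmetric] by blast
    then have "T u = T v" using ij(3) box_of_label[OF assms(1)] by simp
    then show "i = j" using uv inj_onD[OF bij_betw_imp_inj_on[OF Tbij]] by blast
  qed
  let ?v = "inv_into (D - {b}) T k"
  have k: "k \<in> T ` (D - {b})" using Tbij assms(4) by (simp add: bij_betw_def)
  then have v: "?v \<in> D - {b}" "T ?v = k" by (rule inv_into_into, rule f_inv_into_f)
  show ?thesis unfolding tableau_inv_def added
  proof (rule inv_into_f_eq[OF inj])
    show "label D ?v \<in> {1..card D} - {label D b}" using lab v(1) bij_betwE by blast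
    show "T (box_of D (label D ?v)) = k" using v box_of_label[OF assms(1)] by simp
  qed
qed

lemma X_fun_eq_sum_tableaux:
  assumes "finite D" "b \<in> D"
  shows "X_fun D (D - {b}) x = (\<Sum>T\<in>SYT (D - {b}). 1 / tableau_chain (x \<circ> label D) (D - {b}) b T)"
proof -
  let ?E = "D - {b}"
  have "D - ?E = {b}" using assms(2) by blast
  then have added: "added_label D ?E = label D b" by (simp add: added_label_def)
  have card: "card D = Suc (card ?E)" using card_Suc_Diff1[OF assms] by simp
  have "(\<Prod>k = 2..card D - 1. x (tableau_inv D ?E T k) - x (tableau_inv D ?E T (k - 1))) *
      (if card D = 1 then 1 else x (label D b) - x (tableau_inv D ?E T (card D - 1)))
    = tableau_chain (x \<circ> label D) ?E b T" if T: "T \<in> SYT ?E" for T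
  proof -
    note inv = tableau_inv_eq[OF assms T]
    have "card D - 1 = card ?E" using card by simp
    moreover have "(\<Prod>k = 2..card ?E. x (tableau_inv D ?E T k) - x (tableau_inv D ?E T (k - 1)))
      = (\<Prod>k = 2..card ?E. x (label D (inv_into ?E T k)) - x (label D (inv_into ?E T (k - 1))))"
    proof (intro prod.cong refl)
      fix k assume "k \<in> {2..card ?E}"
      then have "k \<in> {1..card ?E}" "k - 1 \<in> {1..card ?E}" by auto
      then show "x (tableau_inv D ?E T k) - x (tableau_inv D ?E T (k - 1))
        = x (label D (inv_into ?E T k)) - x (label D (inv_into ?E T (k - 1)))"
        by (simp only: inv)
    qed
    \<comment> \<open>The two conventions for the closing factor agree: it is 1 exactly when
      \<open>b\<close> is the only box.\<close>
    moreover have "card D = 1 \<longleftrightarrow> ?E = {}" using card assms(1) by simp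
    moreover have "tableau_inv D ?E T (card ?E) = label D (inv_into ?E T (card ?E))" if "?E \<noteq> {}"
    proof -
      have "card ?E \<noteq> 0" using that assms(1) by simp
      then show ?thesis by (intro inv) auto
    qed
    ultimately show ?thesis unfolding tableau_chain_def by simp
  qed
  then show ?thesis unfolding X_fun_def Let_def added by (intro sum.cong) auto
qed

section \<open>Adjacent pairs and edge weights\<close>

text \<open>Labels increase to the right, so the left box comes first and determines the pair.
  Indexing by that box matches \<open>edge_weight\<close>.\<close>

lemma row_pairs_eq:
  assumes "finite D"
  shows "row_pairs D = (\<lambda>(r, c). (label D (r, c), label D (r, c + 1))) ` {(r, c). (r, c) \<in> D \<and> (r, c + 1) \<in> D}"
    (is "_ = ?f ` ?R")
proof
  show "row_pairs D \<subseteq> ?f ` ?R"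
  proof
    fix p assume "p \<in> row_pairs D"
    then obtain b b' where b: "b \<in> D" "b' \<in> D" "label D b < label D b'" "fst b = fst b'"
      "snd b' = snd b + 1 \<or> snd b = snd b' + 1" "p = (label D b, label D b')"
      unfolding row_pairs_def by blast
    have "snd b' = snd b + 1" using b label_less_iff[OF assms, of b b'] by auto
    then have "b' = (fst b, snd b + 1)" using b by (metis prod.collapse)
    then show "p \<in> ?f ` ?R" using b by (intro image_eqI[of _ _ b]) (auto split: prod.split)
  qed
  show "?f ` ?R \<subseteq> row_pairs D"
  proof
    fix p assume "p \<in> ?f ` ?R"
    then obtain r c where "(r, c) \<in> D" "(r, c + 1) \<in> D" "p = (label D (r, c), label D (r, c + 1))"
      by auto
    then show "p \<in> row_pairs D"
      using label_less[OF assms, of "(r, c + 1)" "(r, c)"] unfolding row_pairs_def by fastforce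
  qed
qed

lemma col_pairs_eq:
  assumes "finite D"
  shows "col_pairs D = (\<lambda>(r, c). (label D (r, c), label D (r + 1, c))) ` {(r, c). (r, c) \<in> D \<and> (r + 1, c) \<in> D}"
    (is "_ = ?f ` ?C")
proof
  show "col_pairs D \<subseteq> ?f ` ?C"
  proof
    fix p assume "p \<in> col_pairs D"
    then obtain b b' where b: "b \<in> D" "b' \<in> D" "label D b < label D b'" "snd b = snd b'"
      "fst b' = fst b + 1 \<or> fst b = fst b' + 1" "p = (label D b, label D b')"
      unfolding col_pairs_def by blast
    have "fst b' = fst b + 1" using b label_less_iff[OF assms, of b b'] by auto
    then have "b' = (fst b + 1, snd b)" using b by (metis prod.collapse)
    then show "p \<in> ?f ` ?C" using b by (intro image_eqI[of _ _ b]) (auto split: prod.split)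
  qed
  show "?f ` ?C \<subseteq> col_pairs D"
  proof
    fix p assume "p \<in> ?f ` ?C"
    then obtain r c where "(r, c) \<in> D" "(r + 1, c) \<in> D" "p = (label D (r, c), label D (r + 1, c))"
      by auto
    then show "p \<in> col_pairs D"
      using label_less[OF assms, of "(r + 1, c)" "(r, c)"] unfolding col_pairs_def by fastforce
  qed
qed

text \<open>Injectivity of the labelling lets both products run over boxes instead of pairs of
  labels; a box without the neighbour in question contributes 1.\<close>

lemma prod_row_col_pairs:
  fixes x :: "nat \<Rightarrow> 'f::field"
  assumes "finite D"
  shows "(\<Prod>(a, b)\<in>row_pairs D. x b - x a) * (\<Prod>(a, b)\<in>col_pairs D. x b - x a)
    = (\<Prod>v\<in>D. edge_weight (x \<circ> label D) D v)"
proof -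
  let ?y = "x \<circ> label D"
  have inj: "inj_on (label D) D" using label_bij[OF assms] by (simp add: bij_betw_def)
  have "(\<Prod>(a, b)\<in>row_pairs D. x b - x a)
      = (\<Prod>(r, c)\<in>{(r, c). (r, c) \<in> D \<and> (r, c + 1) \<in> D}. ?y (r, c + 1) - ?y (r, c))"
    unfolding row_pairs_eq[OF assms]
    by (subst prod.reindex) (auto simp: inj_on_def case_prod_beta dest: inj_onD[OF inj])
  also have "\<dots> = (\<Prod>(r, c)\<in>D. if (r, c + 1) \<in> D then ?y (r, c + 1) - ?y (r, c) else 1)"
    using assms by (intro prod.mono_neutral_cong_left) (auto split: if_splits)
  finally have row: "(\<Prod>(a, b)\<in>row_pairs D. x b - x a) = \<dots>" .
  have "(\<Prod>(a, b)\<in>col_pairs D. x b - x a)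
      = (\<Prod>(r, c)\<in>{(r, c). (r, c) \<in> D \<and> (r + 1, c) \<in> D}. ?y (r + 1, c) - ?y (r, c))"
    unfolding col_pairs_eq[OF assms]
    by (subst prod.reindex) (auto simp: inj_on_def case_prod_beta dest: inj_onD[OF inj])
  also have "\<dots> = (\<Prod>(r, c)\<in>D. if (r + 1, c) \<in> D then ?y (r + 1, c) - ?y (r, c) else 1)"
    using assms by (intro prod.mono_neutral_cong_left) (auto split: if_splits)
  finally have col: "(\<Prod>(a, b)\<in>col_pairs D. x b - x a) = \<dots>" .
  show ?thesis
    unfolding row col prod.distrib[symmetric] edge_weight_def by (intro prod.cong) auto
qed

section \<open>Specialization to indeterminates\<close>

lemma inj_indet: "inj (indet :: nat \<Rightarrow> 'k::field ratfun)"
proof (rule injI)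
  fix i j assume "(indet i :: 'k ratfun) = indet j"
  then have "Poly_Mapping.single (Poly_Mapping.single i (1::nat)) (1::'k)
      = Poly_Mapping.single (Poly_Mapping.single j 1) 1"
    by (simp add: indet_def eq_fract)
  \<comment> \<open>Comparing coefficients identifies the monomials; comparing exponents afterwards
    identifies the indices.\<close>
  then have "Poly_Mapping.single i (1::nat) = Poly_Mapping.single j 1"
    by (metis lookup_single_eq lookup_single_not_eq zero_neq_one)
  then show "i = j"
    by (metis lookup_single_eq lookup_single_not_eq zero_neq_one)
qed

theorem theorem4p3:
  fixes la mu nu :: "nat list" and n m l i :: nat and d s :: "nat \<Rightarrow> nat"
    and x :: "nat \<Rightarrow> 'k::field ratfun"
  assumes "is_partition la" "is_partition mu" "is_partition nu"
    and "diagram nu \<subseteq> diagram mu" and "diagram mu \<subset> diagram la" and "adds_one_box mu la"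
    and "card (skew la nu) = n"
    and "broken_border_strip (skew la nu)"
    and "bij_betw d {1..m} (label (skew la nu) ` dull_boxes (skew la nu))"
    and "i \<in> {1..m}" and "d i = label (skew la nu) (the_elem (skew la mu))"
    and "bij_betw s {1..l} (label (skew la nu) ` sharp_corners (skew la nu))"
  defines "x \<equiv> indet"
  shows "X_fun (skew la nu) (skew mu nu) x =
    (\<Prod>j = 1..l. x (d i) - x (s j)) / (\<Prod>j \<in> {1..m} - {i}. x (d i) - x (d j)) *
    (1 / ((\<Prod>(a, b) \<in> row_pairs (skew la nu). x b - x a) *
          (\<Prod>(a, b) \<in> col_pairs (skew la nu). x b - x a)))"
proof -
  let ?D = "skew la nu"
  \<comment> \<open>Boxes of the smaller shape keep their labels from \<open>?D\<close>, as in
    \<open>X_fun\<close>.\<close>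
  let ?y = "x \<circ> label ?D"
  obtain b where b: "b \<notin> diagram mu" "diagram la = insert b (diagram mu)"
    using assms(6) unfolding adds_one_box_def by blast
  have bD: "b \<in> ?D" and E: "skew mu nu = ?D - {b}" and "skew la mu = {b}"
    using b assms(4) by (auto simp: skew_def)
  then have di: "d i = label ?D b" using assms(11) by simp
  have fin: "finite ?D" using finite_diagram by (simp add: skew_def)
  have injl: "inj_on (label ?D) ?D" using label_bij[OF fin] by (simp add: bij_betw_def)
  have injy: "inj_on ?y ?D"
    using injl inj_indet unfolding x_def by (intro comp_inj_on) (auto intro: inj_on_subset)
  have sub: "dull_boxes ?D \<subseteq> ?D" "sharp_corners ?D \<subseteq> ?D"
    by (auto simp: dull_boxes_def sharp_corners_def)
  \<comment> \<open>The label of \<open>b\<close> is listed among those of the dull boxes;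
    injectivity of the labelling carries this back to \<open>b\<close>.\<close>
  have "label ?D b \<in> label ?D ` dull_boxes ?D"
    using assms(9,10) di bij_betwE by metis
  then have dull: "b \<in> dull_boxes ?D"
    using injl bD sub(1) by (auto dest: inj_onD)
  then have nsharp: "b \<notin> sharp_corners ?D" by (auto simp: dull_boxes_def sharp_corners_def)
  have "X_fun ?D (?D - {b}) x = (\<Prod>v\<in>?D - {b}. box_factor ?y (?D - {b}) (?y b) v)"
    unfolding X_fun_eq_sum_tableaux[OF fin bD]
  proof (rule sum_tableaux_eq_prod)
    show "rowcol_convex (?D - {b})"
      unfolding E[symmetric] by (rule rowcol_convex_skew[OF assms(2,3)])
    show "no_hook (?D - {b})"
      using no_hook_skew[OF assms(1,3,8)] by (rule no_hook_subset) auto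
    show "?y b \<notin> ?y ` (?D - {b})" using injy bD by (auto simp: inj_on_def)
  qed (use fin injy in \<open>auto intro: inj_on_subset\<close>)
  \<comment> \<open>This passes from the corners and edges of the smaller shape to those of
    \<open>?D\<close>; it works because the factors are evaluated at the value of the removed box
    \<open>b\<close>.\<close>
  also have "\<dots> = (\<Prod>v\<in>?D - {b}. box_factor ?y ?D (?y b) v)"
    using injy bD by (intro prod.cong box_factor_remove) (auto simp: inj_on_def)
  also have "\<dots> = (\<Prod>v\<in>(?D - {b}) \<inter> sharp_corners ?D. ?y b - ?y v) /
      ((\<Prod>v\<in>(?D - {b}) \<inter> dull_boxes ?D. ?y b - ?y v) * (\<Prod>v\<in>?D - {b}. edge_weight ?y ?D v))"
    using fin by (intro prod_box_factor) auto
  also have "(?D - {b}) \<inter> sharp_corners ?D = sharp_corners ?D" using sub nsharp by auto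
  also have "(?D - {b}) \<inter> dull_boxes ?D = dull_boxes ?D - {b}" using sub by auto
  also have "(\<Prod>v\<in>?D - {b}. edge_weight ?y ?D v) = (\<Prod>v\<in>?D. edge_weight ?y ?D v)"
    using fin bD dull
    by (cases b) (simp add: prod.remove[of ?D b] edge_weight_def dull_boxes_def)
  also have "\<dots> = (\<Prod>(a, b)\<in>row_pairs ?D. x b - x a) * (\<Prod>(a, b)\<in>col_pairs ?D. x b - x a)"
    using prod_row_col_pairs[OF fin] by (rule sym)
  also have "(\<Prod>v\<in>sharp_corners ?D. ?y b - ?y v) = (\<Prod>j = 1..l. x (d i) - x (s j))"
  proof -
    have "(\<Prod>j = 1..l. x (d i) - x (s j)) = (\<Prod>k\<in>label ?D ` sharp_corners ?D. x (d i) - x k)"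
      using assms(12) by (rule prod.reindex_bij_betw)
    also have "\<dots> = (\<Prod>v\<in>sharp_corners ?D. ?y b - ?y v)"
      using inj_on_subset[OF injl sub(2)] by (simp add: prod.reindex di)
    finally show ?thesis by simp
  qed
  also have "(\<Prod>v\<in>dull_boxes ?D - {b}. ?y b - ?y v) = (\<Prod>j\<in>{1..m} - {i}. x (d i) - x (d j))"
  proof -
    have "bij_betw d ({1..m} - {i}) (label ?D ` dull_boxes ?D - {d i})"
      by (rule bij_betw_remove[OF assms(9,10)])
    moreover have "label ?D ` dull_boxes ?D - {d i} = label ?D ` (dull_boxes ?D - {b})"
      using inj_on_subset[OF injl sub(1)] dull by (auto simp: di inj_on_def)
    ultimately have "bij_betw d ({1..m} - {i}) (label ?D ` (dull_boxes ?D - {b}))" by simp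
    then have "(\<Prod>j\<in>{1..m} - {i}. x (d i) - x (d j))
        = (\<Prod>k\<in>label ?D ` (dull_boxes ?D - {b}). x (d i) - x k)"
      by (rule prod.reindex_bij_betw)
    also have "\<dots> = (\<Prod>v\<in>dull_boxes ?D - {b}. ?y b - ?y v)"
      using inj_on_subset[OF injl, of "dull_boxes ?D - {b}"] sub(1)
      by (subst prod.reindex) (auto simp: di)
    finally show ?thesis by simp
  qed
  finally show ?thesis unfolding E by simp
qed

end
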